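(* Let $\Sigma$ be a $d$-dimensional simplicial complex and let $i\in\Sigma_0$ be a vertex. Let $\Lambda$ be a copy of the $d$-dimensional lexicographically greedy rigid complex (LGRC) with vertex set the neighbours of $i$ in $\Sigma$. If $\Lambda_{d-1}\subseteq\mathrm{Lk}(i)$ and $\Sigma-i+\Lambda$ is generically globally $d$-volume rigid in $\mathbb{R}^d$, then $\Sigma$ is generically globally $d$-volume rigid in $\mathbb{R}^d$.
   Context: A simplicial complex is a collection of subsets of a finite vertex set closed under taking subsets. $\Sigma_k$ is the set of $k$-simplices (elements of size $k+1$); $\Sigma$ is $d$-dimensional if $d$ is the largest integer with $\Sigma_d\ne\varnothing$, and $d$-dimensional complexes are assumed pure (every simplex is contained in a $d$-simplex). The neighbours of a vertex $i$ are the vertices $j\neq i$ with $\{i,j\}\in\Sigma_1$. The link $\mathrm{Lk}(i)$ is the collection of $(d-1)$-simplices $\tau$ with $i\notin\tau$ such that $\tau\cup\{i\}\in\Sigma_d$. $\Sigma-i$ is the complex, on vertex set $\Sigma_0\setminus\{i\}$, of the simplices of $\Sigma$ not containing $i$, and $\Sigma-i+\Lambda$ is its union with $\Lambda$. LGRC: for $m\ge d+1$, the $d$-dimensional LGRC on $m$ vertices is the simplicial complex on $[m]=\{1,\dots,m\}$ whose maximal simplices are the $(d+1)$-subsets $\{i_1<\dots<i_{d+1}\}$ that are componentwise at most $(1,3,4,\dots,d+1,m)$; explicitly, $\{1,2,\dots,d+1\}$ together with all $\{1\}\cup I\cup\{j\}$ with $I\subseteq\{2,\dots,d+1\}$, $|I|=d-1$,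 and $d+2\le j\le m$. A copy of the LGRC with vertex set $W$, $|W|=m\geq d+1$, is its image under a bijection $[m]\to W$. Global rigidity: for a $d$-dimensional complex $\Sigma$ with ordered vertex set identified with $[n]$ and a configuration $p=(p(1),\dots,p(n))\in(\mathbb{R}^d)^n$, let $\alpha_\Sigma(p)\in\mathbb{R}^{\Sigma_d}$ be the vector of signed volumes $\begin{vmatrix}1&\dots&1\\ p(i_1)&\dots&p(i_{d+1})\end{vmatrix}$ over $\{i_1<\dots<i_{d+1}\}\in\Sigma_d$, and let $\alpha_n^d$ be the same map with all $(d+1)$-subsets of $[n]$ in place of $\Sigma_d$. The framework $(\Sigma,p)$ is globally $d$-volume rigid in $\mathbb{R}^d$ if for all $q\in(\mathbb{R}^d)^n$, $\alpha_\Sigma(p)=\alpha_\Sigma(q)$ implies $\alpha_n^d(p)=\alpha_n^d(q)$. A configuration $p$ is generic if no nonzero polynomial with rational coefficients in $dn$ variables vanishes at $p$. $\Sigma$ is generically globally $d$-volume rigid in $\mathbb{R}^d$ if $(\Sigma,p)$ is globally $d$-volume rigid for every generic $p\in(\mathbb{R}^d)^n$. *)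

theory Defs
  imports
    "HOL-Library.FuncSet"
    "HOL-Library.Poly_Mapping"
    "Jordan_Normal_Form.Determinant"
begin

text \<open>
  A simplicial complex is the set of its simplices.  The empty simplex may belong to it, and its
  vertices are the elements of its simplices.
\<close>

definition simplicial_complex :: "'v set set \<Rightarrow> bool" where
  "simplicial_complex K \<longleftrightarrow> finite (\<Union>K) \<and> (\<forall>\<sigma>\<in>K. \<forall>\<tau>. \<tau> \<subseteq> \<sigma> \<longrightarrow> \<tau> \<in> K)"

definition simplices :: "'v set set \<Rightarrow> nat \<Rightarrow> 'v set set" where
  "simplices K k = {\<sigma> \<in> K. card \<sigma> = k + 1}"

definition vertices :: "'v set set \<Rightarrow> 'v set" where
  "vertices K = {v. {v} \<in> K}"

definition dimensional :: "nat \<Rightarrow> 'v set set \<Rightarrow> bool" where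
  "dimensional d K \<longleftrightarrow> simplices K d \<noteq> {} \<and> (\<forall>k>d. simplices K k = {})"

definition pure :: "nat \<Rightarrow> 'v set set \<Rightarrow> bool" where
  "pure d K \<longleftrightarrow> (\<forall>\<sigma>\<in>K. \<exists>\<tau>\<in>simplices K d. \<sigma> \<subseteq> \<tau>)"

definition neighbours :: "'v set set \<Rightarrow> 'v \<Rightarrow> 'v set" where
  "neighbours K i = {j. j \<noteq> i \<and> {i, j} \<in> simplices K 1}"

text \<open>
  Only the \<open>(d - 1)\<close>-simplices of the link are recorded.  In dimension \<open>0\<close> the truncated
  subtraction plays no role: a vertex then has no neighbours, hence there is no LGRC on them.
\<close>

definition link :: "nat \<Rightarrow> 'v set set \<Rightarrow> 'v \<Rightarrow> 'v set set" where
  "link d K i = {\<tau> \<in> simplices K (d - 1). i \<notin> \<tau> \<and> \<tau> \<union> {i} \<in> simplices K d}"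

definition delete_vertex :: "'v set set \<Rightarrow> 'v \<Rightarrow> 'v set set" where
  "delete_vertex K i = {\<sigma> \<in> K. i \<notin> \<sigma>}"


text \<open>
  \<open>lgrc_bound d m k\<close> is entry \<open>k\<close> (counting from \<open>0\<close>) of the tuple \<open>(1, 3, 4, \<dots>, d + 1, m)\<close>
  of length \<open>d + 1\<close>.
\<close>

definition lgrc_bound :: "nat \<Rightarrow> nat \<Rightarrow> nat \<Rightarrow> nat" where
  "lgrc_bound d m k = (if k = 0 then 1 else if k = d then m else k + 2)"

definition lgrc_facets :: "nat \<Rightarrow> nat \<Rightarrow> nat set set" where
  "lgrc_facets d m = {\<sigma>. \<sigma> \<subseteq> {1..m} \<and> card \<sigma> = d + 1 \<and>
     (\<forall>k\<le>d. sorted_list_of_set \<sigma> ! k \<le> lgrc_bound d m k)}"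

definition lgrc :: "nat \<Rightarrow> nat \<Rightarrow> nat set set" where
  "lgrc d m = {\<tau>. \<exists>\<sigma>\<in>lgrc_facets d m. \<tau> \<subseteq> \<sigma>}"

definition lgrc_copy :: "nat \<Rightarrow> 'v set \<Rightarrow> 'v set set \<Rightarrow> bool" where
  "lgrc_copy d W L \<longleftrightarrow> finite W \<and> card W \<ge> d + 1 \<and>
     (\<exists>f. bij_betw f {1..card W} W \<and> L = (\<lambda>\<sigma>. f ` \<sigma>) ` lgrc d (card W))"


text \<open>
  The order on the vertices is that of the type \<open>'v\<close>, and \<open>sorted_list_of_set\<close> plays the role of
  the identification of the vertex set with \<open>{1..n}\<close>.  A configuration on the vertex set \<open>V\<close> is a
  map in \<open>V \<rightarrow> carrier_vec d\<close>; its values outside \<open>V\<close> are irrelevant.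
\<close>

definition signed_volume :: "nat \<Rightarrow> ('v::linorder \<Rightarrow> real vec) \<Rightarrow> 'v set \<Rightarrow> real" where
  "signed_volume d p \<sigma> =
     det (mat_of_cols (d + 1) (map (\<lambda>v. vCons 1 (p v)) (sorted_list_of_set \<sigma>)))"

definition volumes :: "nat \<Rightarrow> 'v::linorder set set \<Rightarrow> ('v \<Rightarrow> real vec) \<Rightarrow> 'v set \<Rightarrow> real" where
  "volumes d K p = restrict (signed_volume d p) (simplices K d)"

definition all_volumes :: "nat \<Rightarrow> 'v::linorder set \<Rightarrow> ('v \<Rightarrow> real vec) \<Rightarrow> 'v set \<Rightarrow> real" where
  "all_volumes d V p = restrict (signed_volume d p) {\<sigma>. \<sigma> \<subseteq> V \<and> card \<sigma> = d + 1}"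

definition globally_volume_rigid :: "nat \<Rightarrow> 'v::linorder set set \<Rightarrow> ('v \<Rightarrow> real vec) \<Rightarrow> bool" where
  "globally_volume_rigid d K p \<longleftrightarrow>
     (\<forall>q \<in> vertices K \<rightarrow> carrier_vec d.
        volumes d K p = volumes d K q \<longrightarrow>
        all_volumes d (vertices K) p = all_volumes d (vertices K) q)"


text \<open>
  Polynomials with rational coefficients in variables from \<open>'x\<close>: a monomial is a finitely supported
  exponent map \<open>'x \<Rightarrow>\<^sub>0 nat\<close>, a polynomial a finitely supported coefficient map on monomials.
\<close>

type_synonym 'x rat_mpoly = "('x \<Rightarrow>\<^sub>0 nat) \<Rightarrow>\<^sub>0 rat"

definition mpoly_vars :: "'x rat_mpoly \<Rightarrow> 'x set" where
  "mpoly_vars P = (\<Union>m\<in>Poly_Mapping.keys P. Poly_Mapping.keys m)"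

definition mpoly_eval :: "('x \<Rightarrow> real) \<Rightarrow> 'x rat_mpoly \<Rightarrow> real" where
  "mpoly_eval a P = (\<Sum>m\<in>Poly_Mapping.keys P. of_rat (Poly_Mapping.lookup P m) *
     (\<Prod>x\<in>Poly_Mapping.keys m. a x ^ Poly_Mapping.lookup m x))"

text \<open>The variable \<open>(v, k)\<close> stands for coordinate \<open>k\<close> of the point at the vertex \<open>v\<close>.\<close>

definition generic_configuration :: "nat \<Rightarrow> 'v set \<Rightarrow> ('v \<Rightarrow> real vec) \<Rightarrow> bool" where
  "generic_configuration d V p \<longleftrightarrow>
     (\<forall>P :: ('v \<times> nat) rat_mpoly. P \<noteq> 0 \<longrightarrow> mpoly_vars P \<subseteq> V \<times> {..<d} \<longrightarrow>
        mpoly_eval (\<lambda>(v, k). p v $ k) P \<noteq> 0)"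

definition generically_globally_volume_rigid :: "nat \<Rightarrow> 'v::linorder set set \<Rightarrow> bool" where
  "generically_globally_volume_rigid d K \<longleftrightarrow>
     (\<forall>p \<in> vertices K \<rightarrow> carrier_vec d.
        generic_configuration d (vertices K) p \<longrightarrow> globally_volume_rigid d K p)"

end

theory Submission
  imports Defs
begin

text \<open>
  Write \<open>V\<close> for the vertex set of \<open>K\<close> and \<open>L\<close> for the LGRC on the neighbours of \<open>i\<close>.  Let \<open>p\<close> be
  generic and let \<open>q\<close> give every facet of \<open>K\<close> the same volume as \<open>p\<close>.

  The first point is that the volumes of the facets \<open>\<sigma>\<close> of \<open>L\<close>, which need not belong to \<open>K\<close>, also
  agree for \<open>p\<close> and \<open>q\<close>.  The boundary of the simplex on \<open>insert i \<sigma>\<close> is a cycle, so the signed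
  volumes of its facets have alternating sum zero (\<open>alternating_sum_of_facet_volumes\<close>).  All these
  facets other than \<open>\<sigma>\<close> are cones from \<open>i\<close> over faces of \<open>\<sigma>\<close>, and they lie in \<open>K\<close> because the
  \<open>(d - 1)\<close>-simplices of \<open>L\<close> lie in the link of \<open>i\<close>.  Hence they determine the volume of \<open>\<sigma>\<close>
  (\<open>signed_volume_determined_by_cone\<close>).  So \<open>p\<close> and \<open>q\<close> agree on the facets of the complex obtained
  by deleting \<open>i\<close> and adding \<open>L\<close>.  Its vertex set is \<open>V - {i}\<close>, where \<open>p\<close> is still generic, and
  its rigidity gives equal volumes for all \<open>(d + 1)\<close>-subsets of \<open>V - {i}\<close>.

  It remains to bring \<open>i\<close> back.  Fix one facet \<open>\<sigma>\<close> of \<open>L\<close>.  Its volume at \<open>p\<close> is a nonzero rational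
  polynomial in the coordinates, hence not zero (\<open>generic_list_volume_nonzero\<close>), so the points of
  \<open>\<sigma>\<close> form an affine basis.  By Cramer's rule the barycentric coordinates of the point at a vertex
  \<open>v\<close> are quotients by the volume of \<open>\<sigma>\<close> of the volumes obtained by putting \<open>v\<close> in place of a
  vertex of \<open>\<sigma>\<close>.  These volumes agree for \<open>p\<close> and \<open>q\<close>: if \<open>v\<close> is not \<open>i\<close>, by the previous
  paragraph, and if \<open>v\<close> is \<open>i\<close>, because the simplices concerned are the cones above.  Therefore
  one affine map of determinant \<open>1\<close> carries \<open>p\<close> to \<open>q\<close> on all of \<open>V\<close>, and every volume is
  preserved (\<open>volumes_determined_by_replacements\<close>).
\<close>


section \<open>Volumes of ordered simplices\<close>

text \<open>
  The vertices may come in any order and may repeat.  This makes it possible to replace a vertex or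
  to put a cone point in front without sorting again.
\<close>

definition list_volume :: "nat \<Rightarrow> ('v \<Rightarrow> real vec) \<Rightarrow> 'v list \<Rightarrow> real" where
  "list_volume d p xs = det (mat_of_cols (d + 1) (map (\<lambda>v. vCons 1 (p v)) xs))"

lemma signed_volume_eq_list_volume:
  "signed_volume d p \<sigma> = list_volume d p (sorted_list_of_set \<sigma>)"
  by (simp add: signed_volume_def list_volume_def)

lemma list_volume_permute:
  assumes \<pi>: "\<pi> permutes {..<d + 1}" and xs: "length xs = d + 1"
  shows "list_volume d p (permute_list \<pi> xs) = signof \<pi> * list_volume d p xs"
proof -
  let ?A = "mat_of_cols (d + 1) (map (\<lambda>v. vCons 1 (p v)) xs)"
  let ?B = "mat_of_cols (d + 1) (map (\<lambda>v. vCons 1 (p v)) (permute_list \<pi> xs))"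
  have A: "?A \<in> carrier_mat (d + 1) (d + 1)" and B: "?B \<in> carrier_mat (d + 1) (d + 1)"
    using xs by (metis mat_of_cols_carrier(1) length_map length_permute_list)+
  have bound: "\<pi> j < d + 1" if "j < d + 1" for j
    using permutes_in_image[OF \<pi>] that by auto
  have "?B\<^sup>T = mat (d + 1) (d + 1) (\<lambda>(i, j). ?A\<^sup>T $$ (\<pi> i, j))"
  proof (rule eq_matI)
    fix i j assume "i < dim_row (mat (d + 1) (d + 1) (\<lambda>(i, j). ?A\<^sup>T $$ (\<pi> i, j)))"
      and "j < dim_col (mat (d + 1) (d + 1) (\<lambda>(i, j). ?A\<^sup>T $$ (\<pi> i, j)))"
    then have i: "i < d + 1" and j: "j < d + 1"
      by simp_all
    show "?B\<^sup>T $$ (i, j) = mat (d + 1) (d + 1) (\<lambda>(i, j). ?A\<^sup>T $$ (\<pi> i, j)) $$ (i, j)"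
      using i j bound[OF i] xs \<pi> by (simp add: mat_of_cols_index permute_list_nth)
  qed (use xs in simp_all)
  then have "det ?B\<^sup>T = signof \<pi> * det ?A\<^sup>T"
    using det_permute_rows[of "?A\<^sup>T" "d + 1" \<pi>] A \<pi> by (simp add: atLeast0LessThan)
  then show ?thesis
    using det_transpose[OF A] det_transpose[OF B] by (simp add: list_volume_def)
qed

text \<open>
  The two orders of the vertices differ by a permutation whose sign does not depend on the
  configuration.  Equalities between configurations can therefore be moved freely between sets
  and enumerations of them.
\<close>

lemma list_volume_eq_if_signed_volume_eq:
  assumes xs: "distinct xs" "length xs = d + 1"
    and eq: "signed_volume d p (set xs) = signed_volume d q (set xs)"
  shows "list_volume d p xs = list_volume d q xs"
proof -
  let ?ys = "sorted_list_of_set (set xs)"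
  have "mset xs = mset ?ys"
    using xs(1) by (simp add: sorted_list_of_set_sort_remdups distinct_remdups_id)
  then obtain \<pi> where \<pi>: "\<pi> permutes {..<length ?ys}" "permute_list \<pi> ?ys = xs"
    by (rule mset_eq_permutation)
  have len: "length ?ys = d + 1"
    using xs by (simp add: distinct_card)
  have "list_volume d r xs = signof \<pi> * signed_volume d r (set xs)" for r
    using list_volume_permute[of \<pi> d ?ys r] \<pi> len by (simp add: signed_volume_eq_list_volume)
  then show ?thesis
    using eq by simp
qed

lemma list_volume_repeated_vertex:
  assumes "length xs = d + 1" "j \<noteq> k" "j < d + 1" "k < d + 1" "xs ! j = xs ! k"
  shows "list_volume d p xs = 0"
  unfolding list_volume_def
  by (rule det_identical_columns[where n = "d + 1" and i = j and j = k])
     (use assms in \<open>auto simp: mat_of_cols_def col_def\<close>)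


section \<open>The boundary relation\<close>

text \<open>
  The homogeneous coordinates of \<open>d + 2\<close> points form a \<open>(d + 1) \<times> (d + 2)\<close> matrix whose first row
  consists of ones.  With another row of ones on top its determinant vanishes, and expansion along
  the new row gives the relation.
\<close>

lemma alternating_sum_of_facet_volumes:
  assumes xs: "length xs = d + 2"
  shows "(\<Sum>j<d + 2. (-1) ^ j * list_volume d p (take j xs @ drop (Suc j) xs)) = 0"
proof -
  let ?A = "mat (d + 2) (d + 2)
    (\<lambda>(r, c). if r = 0 then 1 else vCons 1 (p (xs ! c)) $ (r - 1)) :: real mat"
  have del: "mat_delete ?A 0 j =
      mat_of_cols (d + 1) (map (\<lambda>v. vCons 1 (p v)) (take j xs @ drop (Suc j) xs))"
    if "j < d + 2" for j
    using that xs
    by (intro eq_matI) (auto simp: mat_delete_def mat_of_cols_def nth_append min_def)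
  have "det ?A = 0"
    by (rule det_identical_rows[where n = "d + 2" and i = 0 and j = 1])
       (auto simp: row_def)
  moreover have "det ?A = (\<Sum>j<d + 2. ?A $$ (0, j) * cofactor ?A 0 j)"
    by (rule laplace_expansion_row) auto
  moreover have "(\<Sum>j<d + 2. ?A $$ (0, j) * cofactor ?A 0 j)
      = (\<Sum>j<d + 2. (-1) ^ j * list_volume d p (take j xs @ drop (Suc j) xs))"
  proof (intro sum.cong refl)
    fix j assume "j \<in> {..<d + 2}"
    then have j: "j < d + 2"
      by simp
    show "?A $$ (0, j) * cofactor ?A 0 j
        = (-1) ^ j * list_volume d p (take j xs @ drop (Suc j) xs)"
      unfolding cofactor_def del[OF j] list_volume_def using j by simp
  qed
  ultimately show ?thesis
    by simp
qed

text \<open>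
  In the alternating sum for \<open>insert i \<sigma>\<close>, every facet but \<open>\<sigma>\<close> is a cone from \<open>i\<close>.
\<close>

lemma signed_volume_determined_by_cone:
  assumes \<sigma>: "card \<sigma> = d + 1" and i: "i \<notin> \<sigma>"
    and cone: "\<And>x. x \<in> \<sigma> \<Longrightarrow>
      signed_volume d p (insert i (\<sigma> - {x})) = signed_volume d q (insert i (\<sigma> - {x}))"
  shows "signed_volume d p \<sigma> = signed_volume d q \<sigma>"
proof -
  define xs where "xs = sorted_list_of_set \<sigma>"
  have fin: "finite \<sigma>"
    using \<sigma> by (metis card.infinite Suc_eq_plus1 nat.distinct(1))
  have xs: "distinct xs" "set xs = \<sigma>" "length xs = d + 1"
    using fin \<sigma> by (auto simp: xs_def)
  define face where "face j = i # take j xs @ drop (Suc j) xs" for j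
  have face: "list_volume d p (face j) = list_volume d q (face j)" if j: "j < d + 1" for j
  proof -
    have split: "xs = take j xs @ xs ! j # drop (Suc j) xs"
      using j xs(3) by (simp add: id_take_nth_drop)
    have dist: "distinct (take j xs @ xs ! j # drop (Suc j) xs)"
      using split xs(1) by simp
    have un: "set (take j xs) \<union> {xs ! j} \<union> set (drop (Suc j) xs) = \<sigma>"
      using arg_cong[OF split, of set] xs(2) by auto
    have set: "set (face j) = insert i (\<sigma> - {xs ! j})"
      unfolding un[symmetric] face_def using dist by auto
    have "distinct (face j)"
      using dist un i by (auto simp: face_def)
    moreover have "length (face j) = d + 1"
      using j xs(3) by (simp add: face_def)
    moreover have "xs ! j \<in> \<sigma>"
      using j xs by auto
    ultimately show ?thesis
      using set cone by (intro list_volume_eq_if_signed_volume_eq) simp_all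
  qed
  have "list_volume d r xs = - (\<Sum>j<d + 1. (-1) ^ Suc j * list_volume d r (face j))" for r
    using alternating_sum_of_facet_volumes[of "i # xs" d r] xs(3)
    by (simp add: face_def sum.lessThan_Suc_shift del: sum.lessThan_Suc)
  then show ?thesis
    using face by (simp add: signed_volume_eq_list_volume xs_def[symmetric] del: sum.lessThan_Suc)
qed


section \<open>Frameworks determined by a nondegenerate simplex\<close>

text \<open>
  In homogeneous coordinates the configuration \<open>q\<close> is the image of \<open>p\<close> under one matrix \<open>T\<close>, chosen
  so that it is right on the basis \<open>xs\<close>.  It is right on every other vertex because, by Cramer's
  rule, the replacement volumes fix the coordinates of that vertex with respect to \<open>xs\<close>.
  As \<open>xs\<close> itself keeps its volume, \<open>T\<close> has determinant \<open>1\<close>.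
\<close>

lemma volumes_determined_by_replacements:
  assumes p: "p \<in> V \<rightarrow> carrier_vec d" and q: "q \<in> V \<rightarrow> carrier_vec d"
    and xs: "set xs \<subseteq> V" "length xs = d + 1" and nz: "list_volume d p xs \<noteq> 0"
    and repl: "\<And>v k. v \<in> V \<Longrightarrow> k < d + 1 \<Longrightarrow>
      list_volume d p (xs[k := v]) = list_volume d q (xs[k := v])"
    and ys: "set ys \<subseteq> V" "length ys = d + 1"
  shows "list_volume d p ys = list_volume d q ys"
proof -
  let ?n = "d + 1"
  define hom where "hom r v = vCons 1 (r v)" for r :: "'a \<Rightarrow> real vec" and v
  define M where "M r zs = mat_of_cols ?n (map (hom r) zs)" for r zs
  have vol: "list_volume d r zs = det (M r zs)" for r zs
    by (simp add: list_volume_def M_def hom_def[abs_def])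
  have M [simp]: "M r zs \<in> carrier_mat ?n ?n" if "length zs = ?n" for r zs
    using that by (metis M_def length_map mat_of_cols_carrier(1))
  have hom [simp]: "hom r v \<in> carrier_vec ?n" if "r \<in> V \<rightarrow> carrier_vec d" "v \<in> V" for r v
    using that by (auto simp: hom_def)
  have repl_col: "M r (xs[k := v]) = replace_col (M r xs) (hom r v) k" if "k < ?n" for r k v
    using that xs(2) by (intro eq_matI) (auto simp: M_def mat_of_cols_def replace_col_def)
  \<comment> \<open>The simplex \<open>xs\<close> is itself a replacement: its first vertex by itself.\<close>
  have "xs[0 := xs ! 0] = xs" "xs ! 0 \<in> V"
    using xs by auto
  then have det_eq: "det (M p xs) = det (M q xs)"
    using repl[of "xs ! 0" 0] by (simp add: vol)
  have nzp: "det (M p xs) \<noteq> 0"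
    using nz by (simp add: vol)
  have inv: "\<exists>B \<in> carrier_mat ?n ?n. B * M r xs = 1\<^sub>m ?n \<and> M r xs * B = 1\<^sub>m ?n"
    if "det (M r xs) \<noteq> 0" for r
    using det_non_zero_imp_unit[OF M[OF xs(2)] that]
    unfolding Units_def ring_mat_def by auto
  obtain B where B: "B \<in> carrier_mat ?n ?n" "B * M p xs = 1\<^sub>m ?n" "M p xs * B = 1\<^sub>m ?n"
    using inv[OF nzp] by blast
  obtain C where C: "C \<in> carrier_mat ?n ?n" "C * M q xs = 1\<^sub>m ?n" "M q xs * C = 1\<^sub>m ?n"
    using inv[of q] nzp det_eq by auto
  have cramer: "det (M r xs) * x $ k = det (M r (xs[k := v]))"
    if "k < ?n" "x \<in> carrier_vec ?n" "M r xs *\<^sub>v x = hom r v" for r k v x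
    using cramer_lemma_mat[OF M[OF xs(2), of r] that(2,1)] that by (simp add: repl_col mult.commute)
  define T where "T = M q xs * B"
  have T: "T \<in> carrier_mat ?n ?n"
    using B M[OF xs(2), of q] by (simp add: T_def)
  have transport: "hom q v = T *\<^sub>v hom p v" if v: "v \<in> V" for v
  proof -
    \<comment> \<open>The coordinates of the vertex \<open>v\<close> with respect to \<open>xs\<close> in the two configurations.\<close>
    define x where "x = B *\<^sub>v hom p v"
    define y where "y = C *\<^sub>v hom q v"
    have x: "x \<in> carrier_vec ?n" and y: "y \<in> carrier_vec ?n"
      unfolding x_def y_def
      using mult_mat_vec_carrier[OF B(1) hom[OF p v]] mult_mat_vec_carrier[OF C(1) hom[OF q v]]
      by blast+
    have Mx: "M p xs *\<^sub>v x = hom p v" and My: "M q xs *\<^sub>v y = hom q v"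
      using B C M[OF xs(2)] hom[OF p v] hom[OF q v]
      by (metis x_def assoc_mult_mat_vec one_mult_mat_vec, metis y_def assoc_mult_mat_vec one_mult_mat_vec)
    have "x $ k = y $ k" if k: "k < ?n" for k
      using cramer[OF k x Mx] cramer[OF k y My] repl[OF v k] nzp det_eq
      by (metis vol mult_left_cancel)
    then have "x = y"
      using x y by (intro eq_vecI) auto
    then show ?thesis
      using My B M[OF xs(2), of q] hom[OF p v]
      by (metis T_def assoc_mult_mat_vec x_def)
  qed
  have "M q ys = T * M p ys"
  proof (rule mat_col_eqI)
    fix j assume "j < dim_col (T * M p ys)"
    then have j: "j < ?n"
      using ys(2) by (simp add: M_def)
    then have v: "ys ! j \<in> V"
      using ys by auto
    have col: "col (M r ys) j = hom r (ys ! j)" if "r \<in> V \<rightarrow> carrier_vec d" for r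
      using j ys(2) hom[OF that v] by (simp add: M_def)
    show "col (M q ys) j = col (T * M p ys) j"
      using col[OF p] col[OF q] transport[OF v] col_mult2[OF T M[OF ys(2)] j, of p] by simp
  qed (use T M[OF ys(2), of q] M[OF ys(2), of p] in auto)
  moreover have "det T = 1"
  proof -
    have "det T = det (M q xs) * det B"
      unfolding T_def by (rule det_mult[OF M[OF xs(2)] B(1)])
    also have "\<dots> = det (M p xs * B)"
      using det_mult[OF M[OF xs(2)] B(1)] det_eq by simp
    finally show ?thesis
      using B(3) by simp
  qed
  ultimately show ?thesis
    using det_mult[OF T M[OF ys(2)]] by (simp add: vol)
qed


section \<open>Generic simplices are nondegenerate\<close>

lemma mpoly_eval_superset:
  assumes "finite S" "Poly_Mapping.keys P \<subseteq> S"
  shows "mpoly_eval a P = (\<Sum>m\<in>S. of_rat (Poly_Mapping.lookup P m) *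
     (\<Prod>x\<in>Poly_Mapping.keys m. a x ^ Poly_Mapping.lookup m x))"
  unfolding mpoly_eval_def
  by (rule sum.mono_neutral_left) (use assms in \<open>auto simp: in_keys_iff\<close>)

lemma mpoly_eval_add: "mpoly_eval a (P + Q) = mpoly_eval a P + mpoly_eval a Q"
proof -
  let ?S = "Poly_Mapping.keys P \<union> Poly_Mapping.keys Q"
  have S: "finite ?S" "Poly_Mapping.keys P \<subseteq> ?S" "Poly_Mapping.keys Q \<subseteq> ?S"
    "Poly_Mapping.keys (P + Q) \<subseteq> ?S"
    using Poly_Mapping.keys_add[of P Q] by auto
  show ?thesis
    unfolding S(2-4)[THEN mpoly_eval_superset[OF S(1)]]
    by (simp add: lookup_add of_rat_add algebra_simps sum.distrib)
qed

lemma mpoly_eval_sum: "mpoly_eval a (\<Sum>i\<in>I. P i) = (\<Sum>i\<in>I. mpoly_eval a (P i))"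
  by (induction I rule: infinite_finite_induct)
     (simp_all add: mpoly_eval_add, simp_all add: mpoly_eval_def)

lemma mpoly_eval_single:
  "mpoly_eval a (Poly_Mapping.single m c) =
     of_rat c * (\<Prod>x\<in>Poly_Mapping.keys m. a x ^ Poly_Mapping.lookup m x)"
  by (simp add: mpoly_eval_def)

lemma keys_sum_single:
  assumes "finite I" "inj_on g I"
  shows "Poly_Mapping.keys (\<Sum>i\<in>I. Poly_Mapping.single (g i) (1::nat)) = g ` I"
    and "i \<in> I \<Longrightarrow> Poly_Mapping.lookup (\<Sum>i\<in>I. Poly_Mapping.single (g i) (1::nat)) (g i) = 1"
proof -
  have lookup: "Poly_Mapping.lookup (\<Sum>i\<in>I. Poly_Mapping.single (g i) (1::nat)) x
      = card {i \<in> I. g i = x}" for x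
    using assms(1) by (simp add: lookup_sum lookup_single when_def sum.If_cases Int_def)
  show "Poly_Mapping.keys (\<Sum>i\<in>I. Poly_Mapping.single (g i) (1::nat)) = g ` I"
    using assms(1) by (auto simp: in_keys_iff lookup simp del: One_nat_def)
  assume "i \<in> I"
  then have "{k \<in> I. g k = g i} = {i}"
    using assms(2) by (auto dest: inj_onD)
  then show "Poly_Mapping.lookup (\<Sum>i\<in>I. Poly_Mapping.single (g i) (1::nat)) (g i) = 1"
    by (simp add: lookup del: One_nat_def)
qed

text \<open>
  The Leibniz formula, read as a polynomial.  The row of ones contributes nothing to the monomials,
  and the other rows give distinct variables, so each permutation \<open>\<pi>\<close> yields the square-free monomial
  with the variables \<open>g \<pi> 0, \<dots>, g \<pi> (d - 1)\<close>.
\<close>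

lemma list_volume_is_polynomial:
  assumes xs: "length xs = d + 1"
  obtains P :: "('v \<times> nat) rat_mpoly"
  where "mpoly_vars P \<subseteq> set xs \<times> {..<d}"
    and "\<And>p. mpoly_eval (\<lambda>(v, k). p v $ k) P = list_volume d p xs"
proof -
  define Perms where "Perms = {\<pi>. \<pi> permutes {0..<d + 1}}"
  define g where "g \<pi> i = (xs ! \<pi> (Suc i), i)" for \<pi> :: "nat \<Rightarrow> nat" and i
  define m where "m \<pi> = (\<Sum>i\<in>{..<d}. Poly_Mapping.single (g \<pi> i) (1::nat))" for \<pi>
  define P :: "('v \<times> nat) rat_mpoly"
    where "P = (\<Sum>\<pi>\<in>Perms. Poly_Mapping.single (m \<pi>) (signof \<pi>))"
  have inj: "inj_on (g \<pi>) {..<d}" for \<pi>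
    by (auto simp: g_def inj_on_def)
  have keys: "Poly_Mapping.keys (m \<pi>) = g \<pi> ` {..<d}" for \<pi>
    unfolding m_def by (rule keys_sum_single) (use inj in auto)
  have lookup: "Poly_Mapping.lookup (m \<pi>) (g \<pi> i) = 1" if "i < d" for \<pi> i
    unfolding m_def by (rule keys_sum_single) (use inj that in auto)
  have bound: "\<pi> j < d + 1" if "\<pi> \<in> Perms" "j < d + 1" for \<pi> j
    using that permutes_in_image[of \<pi> "{0..<d + 1}" j] by (auto simp: Perms_def)
  have "Poly_Mapping.keys P \<subseteq> m ` Perms"
    unfolding P_def by (rule order_trans[OF Poly_Mapping.keys_sum]) (auto split: if_splits)
  moreover have "g \<pi> i \<in> set xs \<times> {..<d}" if "\<pi> \<in> Perms" "i < d" for \<pi> i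
    using bound[OF that(1), of "Suc i"] that xs by (auto simp: g_def)
  ultimately have vars: "mpoly_vars P \<subseteq> set xs \<times> {..<d}"
    unfolding mpoly_vars_def by (force simp: keys)
  have "mpoly_eval (\<lambda>(v, k). p v $ k) P = list_volume d p xs" for p
  proof -
    let ?a = "\<lambda>(v, k). p v $ k"
    let ?A = "mat_of_cols (d + 1) (map (\<lambda>v. vCons 1 (p v)) xs)"
    have A: "?A \<in> carrier_mat (d + 1) (d + 1)"
      using xs by (metis mat_of_cols_carrier(1) length_map)
    have "(\<Prod>x\<in>Poly_Mapping.keys (m \<pi>). ?a x ^ Poly_Mapping.lookup (m \<pi>) x)
        = (\<Prod>i<d. p (xs ! \<pi> (Suc i)) $ i)" for \<pi>
      unfolding keys prod.reindex[OF inj] by (auto simp: lookup intro!: prod.cong) (simp add: g_def)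
    moreover have "(\<Prod>i=0..<d + 1. ?A $$ (i, \<pi> i)) = (\<Prod>i<d. p (xs ! \<pi> (Suc i)) $ i)"
      if "\<pi> \<in> Perms" for \<pi>
      using bound[OF that] xs
      by (simp add: atLeast0LessThan prod.lessThan_Suc_shift mat_of_cols_index del: prod.lessThan_Suc)
    ultimately show ?thesis
      unfolding list_volume_def det_def'[OF A] P_def mpoly_eval_sum mpoly_eval_single
      by (simp add: Perms_def)
  qed
  with vars show ?thesis
    using that by blast
qed

text \<open>
  The volume polynomial is not zero, since it takes the value \<open>1\<close> at the standard simplex.
\<close>

lemma generic_list_volume_nonzero:
  assumes gen: "generic_configuration d V p"
    and xs: "distinct xs" "length xs = d + 1" "set xs \<subseteq> V"
  shows "list_volume d p xs \<noteq> 0"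
proof -
  obtain P :: "('a \<times> nat) rat_mpoly" where vars: "mpoly_vars P \<subseteq> set xs \<times> {..<d}"
    and eval: "\<And>p. mpoly_eval (\<lambda>(v, k). p v $ k) P = list_volume d p xs"
    using list_volume_is_polynomial[OF xs(2)] by blast
  \<comment> \<open>The first vertex goes to the origin, the others to the unit vectors.\<close>
  define s :: "'a \<Rightarrow> real vec" where "s v = vec d (\<lambda>k. if v = xs ! Suc k then 1 else 0)" for v
  let ?S = "mat_of_cols (d + 1) (map (\<lambda>v. vCons 1 (s v)) xs)"
  have S: "?S \<in> carrier_mat (d + 1) (d + 1)"
    using xs by (metis mat_of_cols_carrier(1) length_map)
  have entry: "?S $$ (r, c) = (if r = 0 \<or> r = c then 1 else 0)" if "r < d + 1" "c < d + 1" for r c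
    using that xs by (cases r) (auto simp: mat_of_cols_index s_def nth_eq_iff_index_eq)
  have "upper_triangular ?S"
    by (rule upper_triangularI) (use S entry in auto)
  then have "det ?S = prod_list (diag_mat ?S)"
    using S by (rule det_upper_triangular)
  also have "\<dots> = 1"
    unfolding prod_list_diag_prod by (rule prod.neutral) (use S entry in auto)
  finally have "mpoly_eval (\<lambda>(v, k). s v $ k) P = 1"
    by (simp add: eval list_volume_def)
  then have "P \<noteq> 0"
    by (auto simp: mpoly_eval_def)
  moreover have "mpoly_vars P \<subseteq> V \<times> {..<d}"
    using vars xs(3) by auto
  ultimately show ?thesis
    using gen eval[of p] unfolding generic_configuration_def by metis
qed

section \<open>Facets of the LGRC\<close>

text \<open>
  This is the least facet in the componentwise order, so it satisfies every bound.
\<close>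

lemma initial_simplex_in_lgrc_facets:
  assumes "m \<ge> d + 1"
  shows "{1..d + 1} \<in> lgrc_facets d m"
proof -
  have "sorted_list_of_set {1..d + 1} = [1..<d + 2]"
    by (simp add: atLeastLessThanSuc_atLeastAtMost[symmetric] del: upt_Suc)
  then show ?thesis
    using assms by (auto simp: lgrc_facets_def lgrc_bound_def simp del: upt_Suc)
qed

lemma lgrc_copy_subset:
  assumes "lgrc_copy d W L" "\<sigma> \<in> L"
  shows "\<sigma> \<subseteq> W"
  using assms unfolding lgrc_copy_def lgrc_def lgrc_facets_def bij_betw_def by blast

lemma lgrc_copy_down_closed:
  assumes "lgrc_copy d W L" "\<sigma> \<in> L" "\<tau> \<subseteq> \<sigma>"
  shows "\<tau> \<in> L"
proof -
  obtain f \<rho> where f: "L = (\<lambda>\<sigma>. f ` \<sigma>) ` lgrc d (card W)" "\<rho> \<in> lgrc d (card W)" "\<sigma> = f ` \<rho>"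
    using assms unfolding lgrc_copy_def by blast
  obtain \<rho>' where "\<rho>' \<subseteq> \<rho>" "\<tau> = f ` \<rho>'"
    using f(3) assms(3) by (auto simp: subset_image_iff)
  moreover from this have "\<rho>' \<in> lgrc d (card W)"
    using f(2) unfolding lgrc_def by blast
  ultimately show ?thesis
    using f(1) by blast
qed

lemma lgrc_copy_has_simplex:
  assumes "lgrc_copy d W L"
  obtains \<sigma> where "\<sigma> \<in> simplices L d"
proof -
  obtain f where f: "bij_betw f {1..card W} W" "L = (\<lambda>\<sigma>. f ` \<sigma>) ` lgrc d (card W)"
    and W: "card W \<ge> d + 1"
    using assms unfolding lgrc_copy_def by blast
  have "{1..d + 1} \<in> lgrc d (card W)"
    using initial_simplex_in_lgrc_facets[OF W] unfolding lgrc_def by blast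
  moreover have "inj_on f {1..d + 1}"
    by (rule inj_on_subset[OF bij_betw_imp_inj_on[OF f(1)]]) (use W in auto)
  then have "card (f ` {1..d + 1}) = d + 1"
    by (simp add: card_image)
  ultimately show ?thesis
    using f(2) that unfolding simplices_def by blast
qed


section \<open>Coning a vertex over an LGRC\<close>

theorem corollary4p2p1:
  fixes K L :: "'v::linorder set set" and i :: 'v and d :: nat
  assumes "simplicial_complex K" and "dimensional d K" and "pure d K"
    and "i \<in> vertices K"
    and "lgrc_copy d (neighbours K i) L"
    and "simplices L (d - 1) \<subseteq> link d K i"
    and "generically_globally_volume_rigid d (delete_vertex K i \<union> L)"
  shows "generically_globally_volume_rigid d K"
proof -
  let ?V = "vertices K" and ?K' = "delete_vertex K i \<union> L"
  \<comment> \<open>For \<open>d = 0\<close> there are no edges, hence no neighbours to carry an LGRC.\<close>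
  have d: "d > 0"
  proof (rule ccontr)
    assume "\<not> d > 0"
    then have "neighbours K i = {}"
      using assms(2) by (auto simp: dimensional_def neighbours_def)
    then show False
      using assms(5) by (simp add: lgrc_copy_def)
  qed
  have nbr: "v \<in> ?V \<and> v \<noteq> i" if "\<sigma> \<in> L" "v \<in> \<sigma>" for \<sigma> v
  proof -
    have "v \<in> neighbours K i"
      using lgrc_copy_subset[OF assms(5)] that by blast
    then have "v \<noteq> i" "{i, v} \<in> K"
      by (auto simp: neighbours_def simplices_def)
    then show ?thesis
      using assms(1) by (auto simp: simplicial_complex_def vertices_def)
  qed
  have verts: "vertices ?K' = ?V - {i}"
    using nbr by (fastforce simp: vertices_def delete_vertex_def)
  \<comment> \<open>All \<open>(d - 1)\<close>-faces of a facet of \<open>L\<close> lie in the link of \<open>i\<close>.\<close>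
  have cone: "insert i (\<sigma> - {x}) \<in> simplices K d" if "\<sigma> \<in> simplices L d" "x \<in> \<sigma>" for \<sigma> x
  proof -
    have "\<sigma> - {x} \<in> L"
      using lgrc_copy_down_closed[OF assms(5)] that by (auto simp: simplices_def)
    moreover have "card (\<sigma> - {x}) = d - 1 + 1"
      using that d by (simp add: simplices_def)
    ultimately have "\<sigma> - {x} \<in> link d K i"
      using assms(6) by (auto simp: simplices_def)
    then show ?thesis
      by (simp add: link_def)
  qed
  show ?thesis
    unfolding generically_globally_volume_rigid_def globally_volume_rigid_def
  proof (intro ballI impI)
    fix p q
    assume p: "p \<in> ?V \<rightarrow> carrier_vec d" and q: "q \<in> ?V \<rightarrow> carrier_vec d"
      and gen: "generic_configuration d ?V p" and vols: "volumes d K p = volumes d K q"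
    have K: "signed_volume d p \<sigma> = signed_volume d q \<sigma>" if "\<sigma> \<in> simplices K d" for \<sigma>
      using fun_cong[OF vols, of \<sigma>] that by (simp add: volumes_def)
    have L: "signed_volume d p \<sigma> = signed_volume d q \<sigma>" if \<sigma>: "\<sigma> \<in> simplices L d" for \<sigma>
    proof (rule signed_volume_determined_by_cone)
      show "card \<sigma> = d + 1" "i \<notin> \<sigma>"
        using \<sigma> nbr by (auto simp: simplices_def)
    qed (rule K, rule cone[OF \<sigma>])
    have "volumes d ?K' p = volumes d ?K' q"
      unfolding volumes_def
      by (rule restrict_ext) (use K L in \<open>auto simp: simplices_def delete_vertex_def\<close>)
    moreover have "generic_configuration d (?V - {i}) p"
      using gen unfolding generic_configuration_def by blast
    ultimately have all: "all_volumes d (?V - {i}) p = all_volumes d (?V - {i}) q"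
      using assms(7) p q unfolding generically_globally_volume_rigid_def
        globally_volume_rigid_def verts by blast
    have V': "signed_volume d p \<sigma> = signed_volume d q \<sigma>"
      if "\<sigma> \<subseteq> ?V - {i}" "card \<sigma> = d + 1" for \<sigma>
      using fun_cong[OF all, of \<sigma>] that by (simp add: all_volumes_def)
    obtain \<sigma>\<^sub>0 where \<sigma>\<^sub>0: "\<sigma>\<^sub>0 \<in> simplices L d"
      using lgrc_copy_has_simplex[OF assms(5)] .
    define xs where "xs = sorted_list_of_set \<sigma>\<^sub>0"
    have "finite \<sigma>\<^sub>0"
      using \<sigma>\<^sub>0 card.infinite[of \<sigma>\<^sub>0] by (fastforce simp: simplices_def)
    then have xs: "distinct xs" "set xs = \<sigma>\<^sub>0" "length xs = d + 1"
      using \<sigma>\<^sub>0 by (auto simp: xs_def simplices_def)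
    have sub: "\<sigma>\<^sub>0 \<subseteq> ?V - {i}"
      using \<sigma>\<^sub>0 nbr by (auto simp: simplices_def)
    have repl: "list_volume d p (xs[k := v]) = list_volume d q (xs[k := v])"
      if v: "v \<in> ?V" and k: "k < d + 1" for v k
    proof (cases "v \<in> \<sigma>\<^sub>0")
      case True
      then obtain j where j: "j < d + 1" "v = xs ! j"
        using xs by (metis in_set_conv_nth)
      show ?thesis
      proof (cases "j = k")
        case True
        then have "xs[k := v] = xs"
          using j by simp
        then show ?thesis
          using list_volume_eq_if_signed_volume_eq[OF xs(1,3), of p q] L[OF \<sigma>\<^sub>0] xs(2) by simp
      next
        case False
        then have "list_volume d r (xs[k := v]) = 0" for r
          using j k xs(3) by (intro list_volume_repeated_vertex[of _ _ j k]) auto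
        then show ?thesis
          by simp
      qed
    next
      case False
      have dist: "distinct (xs[k := v])" and len: "length (xs[k := v]) = d + 1"
        using xs False by (auto simp: distinct_list_update)
      have set: "set (xs[k := v]) = insert v (\<sigma>\<^sub>0 - {xs ! k})"
        using xs k by (simp add: set_update_distinct)
      have "signed_volume d p (set (xs[k := v])) = signed_volume d q (set (xs[k := v]))"
      proof (cases "v = i")
        case True
        then show ?thesis
          unfolding set using K cone[OF \<sigma>\<^sub>0, of "xs ! k"] k xs by auto
      next
        case False
        show ?thesis
        proof (rule V')
          show "set (xs[k := v]) \<subseteq> ?V - {i}"
            unfolding set using v False sub by auto
          show "card (set (xs[k := v])) = d + 1"
            using distinct_card[OF dist] len by simp
        qed
      qed
      then show ?thesis
        by (rule list_volume_eq_if_signed_volume_eq[OF dist len])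
    qed
    have "list_volume d p xs \<noteq> 0"
      using generic_list_volume_nonzero[OF gen xs(1,3)] xs(2) sub by auto
    moreover have "set xs \<subseteq> ?V"
      using xs(2) sub by auto
    ultimately have "list_volume d p ys = list_volume d q ys"
      if "set ys \<subseteq> ?V" "length ys = d + 1" for ys
      using volumes_determined_by_replacements[OF p q _ xs(3) _ repl that] by simp
    then have "signed_volume d p \<sigma> = signed_volume d q \<sigma>"
      if "\<sigma> \<subseteq> ?V" "card \<sigma> = d + 1" for \<sigma>
      using that card_ge_0_finite[of \<sigma>] by (simp add: signed_volume_eq_list_volume)
    then show "all_volumes d ?V p = all_volumes d ?V q"
      unfolding all_volumes_def by (intro restrict_ext) blast
  qed
qed

end
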